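(* Let $n\in\mathbb{N}$ and let $C$ be any equivalence class in $\mathrm{Alt}(n)$ with support size at most $10$. Then there exists a word $w_C$ (an element of a free group of some finite rank) such that $\mathrm{Alt}(n)_{w_C} = \{e\}\cup C$.
   Context: $\mathrm{Alt}(n)$ is the alternating group acting naturally on $\{1,\dots,n\}$, with identity $e$. For a group $G$ and a word $w$ in the free group of rank $k$, $G_w := \{ w(g_1,\dots,g_k)^{\pm 1} \mid g_i \in G\}$ denotes the set of word values. An equivalence class in a group $G$ is an orbit of the automorphism group $\mathrm{Aut}(G)$ acting on $G$ (hence a union of conjugacy classes). The support of a permutation $a\in\mathrm{Alt}(n)$ is $\{m\in\{1,\dots,n\} \mid m^a\neq m\}$. An equivalence class $C$ in $\mathrm{Alt}(n)$ has support size at most $10$ if every element of $C$ has support of cardinality at most $10$ (for $n\neq 6$ all elements of $C$ have supports of the same cardinality; for $n = 6$ the condition holds automatically). *)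

theory Defs
  imports "HOL-Algebra.Sym_Groups" "HOL-Algebra.Group_Action" "HOL-Algebra.Bij"
begin

text \<open>
  The letter \<open>(i, True)\<close> is the generator \<open>x\<^sub>i\<close> and \<open>(i, False)\<close> is its inverse. The free group of
  rank \<open>k\<close> is realised on the reduced words in \<open>x\<^sub>0, \<dots>, x\<^sub>k\<^sub>-\<^sub>1\<close>, multiplied by concatenation
  followed by free cancellation.
\<close>

type_synonym letter = "nat \<times> bool"

definition inv_letter :: "letter \<Rightarrow> letter" where
  "inv_letter x = (fst x, \<not> snd x)"

definition reduced :: "letter list \<Rightarrow> bool" where
  "reduced = successively (\<lambda>x y. y \<noteq> inv_letter x)"

fun cons_cancel :: "letter \<Rightarrow> letter list \<Rightarrow> letter list" where
  "cons_cancel x [] = [x]"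
| "cons_cancel x (y # w) = (if y = inv_letter x then w else x # y # w)"

definition free_group :: "nat \<Rightarrow> letter list monoid" where
  "free_group k =
     \<lparr>carrier = {w. reduced w \<and> fst ` set w \<subseteq> {..<k}}, mult = foldr cons_cancel, one = []\<rparr>"

definition letter_value :: "('a, 'b) monoid_scheme \<Rightarrow> (nat \<Rightarrow> 'a) \<Rightarrow> letter \<Rightarrow> 'a" where
  "letter_value G g x = (if snd x then g (fst x) else inv\<^bsub>G\<^esub> (g (fst x)))"

text \<open>
  Only the values of \<open>g\<close> below the rank of the free group matter. In \<open>alt_group n\<close> the product is
  \<open>(\<circ>)\<close>, the opposite of the product for permutations acting on the right; reversing words
  translates between the two conventions.
\<close>

definition word_value :: "('a, 'b) monoid_scheme \<Rightarrow> (nat \<Rightarrow> 'a) \<Rightarrow> letter list \<Rightarrow> 'a" where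
  "word_value G g w = foldr (\<lambda>x y. letter_value G g x \<otimes>\<^bsub>G\<^esub> y) w \<one>\<^bsub>G\<^esub>"

definition word_image :: "('a, 'b) monoid_scheme \<Rightarrow> nat \<Rightarrow> letter list \<Rightarrow> 'a set" where
  "word_image G k w =
     (\<Union>g \<in> {..<k} \<rightarrow> carrier G. {word_value G g w, inv\<^bsub>G\<^esub> (word_value G g w)})"

text \<open>The elements of \<open>AutoGroup G\<close> are themselves maps on the carrier, hence the identity action.\<close>

definition equivalence_class :: "('a, 'b) monoid_scheme \<Rightarrow> 'a set \<Rightarrow> bool" where
  "equivalence_class G C \<longleftrightarrow> C \<in> orbits (AutoGroup G) (carrier G) (\<lambda>\<alpha>. \<alpha>)"

definition perm_support :: "nat \<Rightarrow> (nat \<Rightarrow> nat) \<Rightarrow> nat set" where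
  "perm_support n a = {m \<in> {1..n}. a m \<noteq> m}"

lemma inv_letter_inv_letter [simp]: "inv_letter (inv_letter x) = x"
  by (simp add: inv_letter_def)

lemma inv_letter_neq [simp]: "inv_letter x \<noteq> x" "x \<noteq> inv_letter x"
  by (auto simp: inv_letter_def prod_eq_iff)

lemma fst_inv_letter [simp]: "fst (inv_letter x) = fst x"
  by (simp add: inv_letter_def)

lemma reduced_Nil [simp]: "reduced []"
  by (simp add: reduced_def)

lemma reduced_ConsD: "reduced (x # w) \<Longrightarrow> reduced w"
  by (cases w) (auto simp: reduced_def)

lemma reduced_cons_cancel: "reduced w \<Longrightarrow> reduced (cons_cancel x w)"
  by (cases w) (auto simp: reduced_def dest: reduced_ConsD[unfolded reduced_def])

lemma reduced_mult: "reduced v \<Longrightarrow> reduced (foldr cons_cancel u v)"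
  by (induction u) (auto intro: reduced_cons_cancel)

lemma set_cons_cancel: "set (cons_cancel x w) \<subseteq> insert x (set w)"
  by (cases w) auto

lemma set_mult: "set (foldr cons_cancel u v) \<subseteq> set u \<union> set v"
proof (induction u)
  case (Cons x u)
  then show ?case using set_cons_cancel[of x "foldr cons_cancel u v"] by auto
qed simp

lemma cons_cancel_inverse:
  assumes "reduced w"
  shows "cons_cancel x (cons_cancel (inv_letter x) w) = w"
proof (cases w)
  case (Cons y u)
  then show ?thesis using assms by (cases u) (auto simp: reduced_def)
qed simp

lemma mult_Nil: "reduced w \<Longrightarrow> foldr cons_cancel w [] = w"
proof (induction w)
  case (Cons x w)
  then show ?case by (cases w) (auto simp: reduced_def)
qed simp

lemma mult_cons_cancel:
  assumes "reduced v"
  shows "foldr cons_cancel (cons_cancel x u) v = cons_cancel x (foldr cons_cancel u v)"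
proof (cases u)
  case (Cons y u')
  then show ?thesis
    using cons_cancel_inverse[OF reduced_mult[OF assms], of x u'] by auto
qed simp

lemma mult_assoc:
  assumes "reduced w"
  shows "foldr cons_cancel (foldr cons_cancel u v) w = foldr cons_cancel u (foldr cons_cancel v w)"
  by (induction u) (auto simp: mult_cons_cancel[OF assms])

lemma mult_rev_inverse:
  assumes "reduced v"
  shows "foldr cons_cancel (rev (map inv_letter w)) (foldr cons_cancel w v) = v"
proof (induction w)
  case (Cons x w)
  then show ?case
    using cons_cancel_inverse[OF reduced_mult[OF assms], of "inv_letter x" w] by simp
qed (simp add: assms)

lemma reduced_rev_inverse: "reduced w \<Longrightarrow> reduced (rev (map inv_letter w))"
proof -
  assume "reduced w"
  then have "successively (\<lambda>x y. x \<noteq> inv_letter y) w"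
    unfolding reduced_def by (rule successively_mono) auto
  then show ?thesis
    unfolding reduced_def successively_rev successively_map
    by (rule successively_mono) (metis inv_letter_inv_letter)
qed

lemma free_group_is_group: "group (free_group k)"
proof (rule groupI)
  fix u v assume "u \<in> carrier (free_group k)" "v \<in> carrier (free_group k)"
  then show "u \<otimes>\<^bsub>free_group k\<^esub> v \<in> carrier (free_group k)"
    using reduced_mult[of v u] set_mult[of u v] by (fastforce simp: free_group_def)
next
  fix u assume u: "u \<in> carrier (free_group k)"
  have "rev (map inv_letter u) \<in> carrier (free_group k)"
    using u reduced_rev_inverse[of u] by (auto simp: free_group_def image_image)
  moreover have "rev (map inv_letter u) \<otimes>\<^bsub>free_group k\<^esub> u = \<one>\<^bsub>free_group k\<^esub>"
    using u mult_rev_inverse[of "[]" u] by (simp add: free_group_def mult_Nil)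
  ultimately show "\<exists>v \<in> carrier (free_group k). v \<otimes>\<^bsub>free_group k\<^esub> u = \<one>\<^bsub>free_group k\<^esub>"
    by blast
qed (auto simp: free_group_def mult_assoc)

context group
begin

lemma letter_value_closed:
  "g \<in> {..<k} \<rightarrow> carrier G \<Longrightarrow> fst x < k \<Longrightarrow> letter_value G g x \<in> carrier G"
  by (auto simp: letter_value_def)

lemma word_value_closed:
  "g \<in> {..<k} \<rightarrow> carrier G \<Longrightarrow> fst ` set w \<subseteq> {..<k} \<Longrightarrow> word_value G g w \<in> carrier G"
proof (induction w)
  case (Cons x w)
  then show ?case using letter_value_closed[of g k x] by (simp add: word_value_def)
qed (simp add: word_value_def)

lemma word_value_cons_cancel:
  assumes g: "g \<in> {..<k} \<rightarrow> carrier G" and x: "fst x < k" and w: "fst ` set w \<subseteq> {..<k}"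
  shows "word_value G g (cons_cancel x w) = letter_value G g x \<otimes> word_value G g w"
proof (cases w)
  case (Cons y u)
  have u: "word_value G g u \<in> carrier G"
    using g w Cons by (intro word_value_closed) auto
  have gx: "g (fst x) \<in> carrier G"
    using g x by auto
  have "letter_value G g x \<otimes> (letter_value G g (inv_letter x) \<otimes> word_value G g u)
      = word_value G g u"
    using u gx by (simp add: letter_value_def inv_letter_def m_assoc[symmetric])
  then show ?thesis
    using Cons by (auto simp: word_value_def)
qed (simp add: word_value_def)

lemma word_value_hom:
  assumes g: "g \<in> {..<k} \<rightarrow> carrier G"
  shows "word_value G g \<in> hom (free_group k) G"
proof (rule homI)
  fix u v assume "u \<in> carrier (free_group k)" "v \<in> carrier (free_group k)"
  then have u: "fst ` set u \<subseteq> {..<k}" and v: "fst ` set v \<subseteq> {..<k}"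
    by (auto simp: free_group_def)
  from u have "word_value G g (foldr cons_cancel u v) = word_value G g u \<otimes> word_value G g v"
  proof (induction u)
    case Nil
    then show ?case using word_value_closed[OF g v] by (simp add: word_value_def)
  next
    case (Cons x u)
    have uv: "fst ` set (foldr cons_cancel u v) \<subseteq> {..<k}"
      using Cons.prems v set_mult[of u v] by fastforce
    have "word_value G g (foldr cons_cancel (x # u) v)
        = letter_value G g x \<otimes> (word_value G g u \<otimes> word_value G g v)"
      using Cons word_value_cons_cancel[OF g _ uv, of x] by simp
    also have "\<dots> = word_value G g (x # u) \<otimes> word_value G g v"
      using Cons.prems v letter_value_closed[OF g, of x] word_value_closed[OF g, of u]
        word_value_closed[OF g, of v]
      by (simp add: m_assoc word_value_def)
    finally show ?case .
  qed
  then show "word_value G g (u \<otimes>\<^bsub>free_group k\<^esub> v) = word_value G g u \<otimes> word_value G g v"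
    by (simp add: free_group_def)
qed (auto simp: free_group_def intro!: word_value_closed[OF g])

lemma equivalence_class_iff:
  "equivalence_class G C \<longleftrightarrow> (\<exists>x \<in> carrier G. C = {\<alpha> x | \<alpha>. \<alpha> \<in> iso G G})"
proof -
  have "orbit (AutoGroup G) (\<lambda>\<alpha>. \<alpha>) x = {\<alpha> x | \<alpha>. \<alpha> \<in> iso G G}" if x: "x \<in> carrier G" for x
  proof -
    have "(\<lambda>\<alpha>. \<alpha> x) ` auto G = (\<lambda>\<alpha>. \<alpha> x) ` iso G G"
    proof
      show "(\<lambda>\<alpha>. \<alpha> x) ` auto G \<subseteq> (\<lambda>\<alpha>. \<alpha> x) ` iso G G"
        by (rule image_mono) (auto simp: auto_def Bij_def iso_def)
    next
      show "(\<lambda>\<alpha>. \<alpha> x) ` iso G G \<subseteq> (\<lambda>\<alpha>. \<alpha> x) ` auto G"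
      proof (rule image_subsetI)
        fix \<alpha> assume \<alpha>: "\<alpha> \<in> iso G G"
        show "\<alpha> x \<in> (\<lambda>\<alpha>. \<alpha> x) ` auto G"
        proof (rule image_eqI[of _ _ "restrict \<alpha> (carrier G)"])
          show "\<alpha> x = restrict \<alpha> (carrier G) x" using x by simp
          show "restrict \<alpha> (carrier G) \<in> auto G"
            using \<alpha> by (auto simp: auto_def Bij_def iso_def hom_def Pi_def)
        qed
      qed
    qed
    then show ?thesis
      by (simp add: orbit_def AutoGroup_def Setcompr_eq_image)
  qed
  then show ?thesis
    by (auto simp: equivalence_class_def orbits_def)
qed

end

end

theory Submission
  imports Defs "HOL-Algebra.SimpleGroups"
begin

text \<open>
  Let \<open>G\<close> be a finite nonabelian simple group and let \<open>t\<close> be the tuple of all its elements, so that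
  \<open>k = |G|\<close>. Evaluation at a tuple \<open>g\<close> is a homomorphism from the free group of rank \<open>k\<close> to \<open>G\<close>,
  and evaluation at \<open>t\<close> is onto. If the kernel at \<open>g\<close> is contained in the kernel at \<open>t\<close>, then
  \<open>g\<close> is the image of \<open>t\<close> under an automorphism (\<open>automorphism_between_tuples\<close>). For each other tuple
  \<open>g\<close> the kernel at \<open>g\<close> has a nontrivial normal image under evaluation at \<open>t\<close>, hence all of \<open>G\<close> as
  image. Taking commutators, the same follows for the intersection of these finitely many kernels
  (\<open>surj_on_Inter_of_normal_subgroups\<close>). So for every \<open>a\<close> in \<open>G\<close> there is a word with the value \<open>a\<close>
  at \<open>t\<close> and the value \<open>e\<close> at all tuples outside the automorphism orbit of \<open>t\<close>. On that orbit its
  values are exactly the elements equivalent to \<open>a\<close> (\<open>word_values_eq_automorphism_orbit\<close>). This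
  argument is due to Lubotzky.

  For \<open>n \<ge> 5\<close> it applies to \<open>Alt(n)\<close>, whose simplicity is proved by the classical commutator
  computations with 3-cycles (\<open>alt_group_simple\<close>). For \<open>n \<le> 4\<close> every nontrivial element is a 3-cycle or
  a double transposition, and the power words \<open>x\<^sup>4\<close> and \<open>x\<^sup>3\<close> separate the two types
  (\<open>word_for_orbit_in_small_alt_group\<close>).

  A word image also contains the inverses of all word values. This adds nothing, because every
  permutation is conjugate to its inverse in the symmetric group, which acts on \<open>Alt(n)\<close> by
  automorphisms (\<open>inverse_in_automorphism_orbit\<close>).
\<close>

section \<open>Words that distinguish one orbit of generating tuples\<close>

text \<open>
  The kernel of a surjection onto a nonabelian simple group behaves like a prime ideal: if it contains
  an intersection of finitely many normal subgroups, then it contains one of them, since the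
  intersection contains all commutators between them. In the contrapositive, simplicity turns a
  nontrivial image of the intersection into all of \<open>G\<close>, and this stronger form carries the induction.
\<close>

lemma (in simple_group) surj_on_Inter_of_normal_subgroups:
  assumes nonab: "\<not> comm_group G"
    and hom: "group_hom F G \<phi>" and surj: "\<phi> ` carrier F = carrier G"
    and "finite I"
    and "\<And>i. i \<in> I \<Longrightarrow> N i \<lhd> F"
    and "\<And>i. i \<in> I \<Longrightarrow> \<not> N i \<subseteq> kernel F G \<phi>"
  shows "carrier F \<inter> (\<Inter>i\<in>I. N i) \<lhd> F \<and> \<phi> ` (carrier F \<inter> (\<Inter>i\<in>I. N i)) = carrier G"
  using assms(4-6)
proof (induction I rule: finite_induct)
  interpret \<phi>: group_hom F G \<phi> by (rule hom)
  case empty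
  show ?case
    using surj \<phi>.G.normal_invI[OF \<phi>.G.subgroup_self] by simp
next
  interpret \<phi>: group_hom F G \<phi> by (rule hom)
  case (insert i I)
  define M where "M = carrier F \<inter> (\<Inter>i\<in>I. N i)"
  have M: "M \<lhd> F" and surjM: "\<phi> ` M = carrier G"
    using insert.IH insert.prems by (auto simp: M_def)
  have Ni: "N i \<lhd> F"
    using insert.prems by auto
  have sM: "subgroup M F" and sNi: "subgroup (N i) F"
    using M Ni by (auto intro: normal_imp_subgroup)
  have image_normal: "\<phi> ` K \<lhd> G" if "K \<lhd> F" for K
    using that by (rule normal.surj_hom_normal_subgroup[OF _ hom surj])
  have image_whole: "\<phi> ` K = carrier G" if "K \<lhd> F" "\<not> K \<subseteq> kernel F G \<phi>" for K
  proof -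
    have "K \<subseteq> carrier F"
      using that by (simp add: normal_imp_subgroup subgroup.subset)
    then have "\<phi> ` K \<noteq> {\<one>}"
      using that by (auto simp: kernel_def)
    then show ?thesis
      using no_real_normal_subgroup[OF image_normal[OF \<open>K \<lhd> F\<close>]] by blast
  qed
  have MNi: "M \<inter> N i \<lhd> F"
    by (rule \<phi>.G.normal_subgroup_intersect[OF M Ni])
  obtain x y where xy: "x \<in> carrier G" "y \<in> carrier G" "x \<otimes> y \<noteq> y \<otimes> x"
    using nonab group_comm_groupI by blast
  obtain u v where u: "u \<in> M" "\<phi> u = x" and v: "v \<in> N i" "\<phi> v = y"
    using xy surjM image_whole[OF Ni] insert.prems by (metis imageE insertI1)
  have uF: "u \<in> carrier F" and vF: "v \<in> carrier F"
    using u v sM sNi by (auto dest: subgroup.mem_carrier)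
  \<comment> \<open>A commutator of elements of two normal subgroups lies in both; its image is nontrivial.\<close>
  define c where "c = u \<otimes>\<^bsub>F\<^esub> v \<otimes>\<^bsub>F\<^esub> inv\<^bsub>F\<^esub> u \<otimes>\<^bsub>F\<^esub> inv\<^bsub>F\<^esub> v"
  have "c \<in> N i"
    unfolding c_def
    by (intro subgroup.m_closed[OF sNi] normal.inv_op_closed2[OF Ni] uF v
        subgroup.m_inv_closed[OF sNi])
  moreover have "c = u \<otimes>\<^bsub>F\<^esub> (v \<otimes>\<^bsub>F\<^esub> inv\<^bsub>F\<^esub> u \<otimes>\<^bsub>F\<^esub> inv\<^bsub>F\<^esub> v)"
    unfolding c_def using uF vF by (simp add: \<phi>.G.m_assoc)
  then have "c \<in> M"
    using u vF by (auto intro!: subgroup.m_closed[OF sM] normal.inv_op_closed2[OF M]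
        subgroup.m_inv_closed[OF sM])
  moreover have "\<phi> c \<noteq> \<one>"
  proof
    assume "\<phi> c = \<one>"
    then have "x \<otimes> y \<otimes> inv x \<otimes> inv y = \<one>"
      using uF vF u v by (simp add: c_def)
    then have "x \<otimes> y = y \<otimes> x"
      using xy by (metis inv_closed inv_solve_right inv_inv l_one m_closed m_assoc)
    then show False
      using xy by simp
  qed
  ultimately have "\<not> M \<inter> N i \<subseteq> kernel F G \<phi>"
    by (auto simp: kernel_def)
  then have "\<phi> ` (M \<inter> N i) = carrier G"
    by (rule image_whole[OF MNi])
  moreover have "carrier F \<inter> (\<Inter>j\<in>insert i I. N j) = M \<inter> N i"
    by (auto simp: M_def)
  ultimately show ?case
    using MNi by simp
qed

lemma (in group) word_value_cong:
  assumes "\<And>i. i < k \<Longrightarrow> g i = h i" "fst ` set w \<subseteq> {..<k}"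
  shows "word_value G g w = word_value G h w"
  using assms by (induction w) (auto simp: word_value_def letter_value_def)

lemma (in group) word_value_hom_image:
  assumes \<alpha>: "\<alpha> \<in> hom G G" and g: "g \<in> {..<k} \<rightarrow> carrier G" and w: "fst ` set w \<subseteq> {..<k}"
  shows "word_value G (\<alpha> \<circ> g) w = \<alpha> (word_value G g w)"
proof -
  interpret \<alpha>: group_hom G G \<alpha>
    using \<alpha> by unfold_locales
  show ?thesis using w
  proof (induction w)
    case (Cons x w)
    have gx: "g (fst x) \<in> carrier G"
      using g Cons.prems by auto
    have "word_value G g w \<in> carrier G"
      using word_value_closed[OF g] Cons.prems by auto
    then have "\<alpha> (word_value G g (x # w)) = letter_value G (\<alpha> \<circ> g) x \<otimes> \<alpha> (word_value G g w)"
      using gx by (simp add: word_value_def letter_value_def)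
    then show ?case
      using Cons by (simp add: word_value_def letter_value_def)
  qed (simp add: word_value_def)
qed

text \<open>
  If every relation satisfied by \<open>g\<close> also holds for the generating tuple \<open>t\<close>, then mapping the value
  of each word at \<open>g\<close> to its value at \<open>t\<close> is a well-defined homomorphism from the subgroup generated
  by \<open>g\<close> onto \<open>G\<close>. Counting shows that this subgroup is all of \<open>G\<close> and that the homomorphism is
  an automorphism; \<open>\<alpha>\<close> is its inverse.
\<close>

lemma (in group) automorphism_between_tuples:
  assumes fin: "finite (carrier G)"
    and g: "g \<in> {..<k} \<rightarrow> carrier G" and t: "t \<in> {..<k} \<rightarrow> carrier G"
    and surj: "word_value G t ` carrier (free_group k) = carrier G"
    and ker: "kernel (free_group k) G (word_value G g) \<subseteq> kernel (free_group k) G (word_value G t)"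
  obtains \<alpha> where "\<alpha> \<in> iso G G" "\<And>i. i < k \<Longrightarrow> g i = \<alpha> (t i)"
proof -
  let ?F = "free_group k"
  interpret F: group ?F by (rule free_group_is_group)
  interpret g: group_hom ?F G "word_value G g"
    using word_value_hom[OF g] by unfold_locales
  interpret t: group_hom ?F G "word_value G t"
    using word_value_hom[OF t] by unfold_locales
  have well_defined: "word_value G t u = word_value G t v"
    if "u \<in> carrier ?F" "v \<in> carrier ?F" "word_value G g u = word_value G g v" for u v
  proof -
    have "u \<otimes>\<^bsub>?F\<^esub> inv\<^bsub>?F\<^esub> v \<in> kernel ?F G (word_value G g)"
      using that by (simp add: kernel_def)
    then have "word_value G t (u \<otimes>\<^bsub>?F\<^esub> inv\<^bsub>?F\<^esub> v) = \<one>"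
      using ker unfolding kernel_def by blast
    then have "word_value G t u \<otimes> inv (word_value G t v) = \<one>"
      using that by simp
    then show ?thesis
      using that inv_equality[of "word_value G t u" "inv (word_value G t v)"] by simp
  qed
  define \<theta> where "\<theta> x = word_value G t (SOME u. u \<in> carrier ?F \<and> word_value G g u = x)" for x
  have \<theta>: "\<theta> (word_value G g u) = word_value G t u" if "u \<in> carrier ?F" for u
  proof -
    have "\<exists>v. v \<in> carrier ?F \<and> word_value G g v = word_value G g u"
      using that by blast
    from someI_ex[OF this] show ?thesis
      unfolding \<theta>_def using that by (intro well_defined) auto
  qed
  let ?H = "word_value G g ` carrier ?F"
  have H: "?H \<subseteq> carrier G"
    by auto
  have \<theta>H: "\<theta> ` ?H = carrier G"
    using \<theta> surj by (simp add: image_image)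
  then have "card (carrier G) \<le> card ?H"
    by (metis card_image_le fin finite_subset H)
  then have Hall: "?H = carrier G"
    using H fin by (simp add: card_seteq)
  have \<theta>G: "\<theta> ` carrier G = carrier G"
    using \<theta>H unfolding Hall .
  then have "bij_betw \<theta> (carrier G) (carrier G)"
    using fin by (simp add: bij_betw_def finite_surj_inj)
  moreover have "\<theta> \<in> hom G G"
  proof (rule homI)
    fix x y assume "x \<in> carrier G" "y \<in> carrier G"
    then obtain u v where uv: "u \<in> carrier ?F" "v \<in> carrier ?F"
      and xy: "x = word_value G g u" "y = word_value G g v"
      unfolding Hall[symmetric] by blast
    have "\<theta> (x \<otimes> y) = \<theta> (word_value G g (u \<otimes>\<^bsub>?F\<^esub> v))"
      using uv xy by simp
    also have "\<dots> = \<theta> x \<otimes> \<theta> y"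
      using uv by (simp only: \<theta> xy F.m_closed t.hom_mult)
    finally show "\<theta> (x \<otimes> y) = \<theta> x \<otimes> \<theta> y" .
  next
    fix x assume "x \<in> carrier G"
    then show "\<theta> x \<in> carrier G"
      using imageI[of x "carrier G" \<theta>] by (simp only: \<theta>G)
  qed
  ultimately have iso: "\<theta> \<in> iso G G"
    by (simp add: iso_def)
  show thesis
  proof (rule that[of "inv_into (carrier G) \<theta>"])
    show "inv_into (carrier G) \<theta> \<in> iso G G"
      by (rule iso_set_sym[OF iso])
    fix i assume i: "i < k"
    have "[(i, True)] \<in> carrier ?F"
      using i by (simp add: free_group_def reduced_def)
    moreover have gi: "g i \<in> carrier G" and "t i \<in> carrier G"
      using i g t by auto
    ultimately have "\<theta> (g i) = t i"
      using \<theta>[of "[(i, True)]"] by (simp add: word_value_def letter_value_def)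
    moreover have "inv_into (carrier G) \<theta> (\<theta> (g i)) = g i"
      using iso gi by (simp add: iso_def bij_betw_def)
    ultimately show "g i = inv_into (carrier G) \<theta> (t i)"
      by simp
  qed
qed

text \<open>
  Take for \<open>t\<close> an enumeration of all elements of \<open>G\<close>. A tuple outside the automorphism orbit of
  \<open>t\<close> satisfies a relation that \<open>t\<close> violates, so by simplicity some word \<open>w\<close> vanishes at all
  these tuples simultaneously and has the value \<open>a\<close> at \<open>t\<close>. At the tuple \<open>\<alpha> \<circ> t\<close> its value is
  then \<open>\<alpha> a\<close>.
\<close>

theorem (in simple_group) word_values_eq_automorphism_orbit:
  assumes fin: "finite (carrier G)" and nonab: "\<not> comm_group G" and a: "a \<in> carrier G"
  obtains k w where "w \<in> carrier (free_group k)"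
    "(\<lambda>g. word_value G g w) ` ({..<k} \<rightarrow> carrier G) = {\<one>} \<union> {\<alpha> a | \<alpha>. \<alpha> \<in> iso G G}"
proof -
  define k where "k = card (carrier G)"
  let ?F = "free_group k"
  interpret F: group ?F by (rule free_group_is_group)
  obtain t where t: "bij_betw t {..<k} (carrier G)"
    using ex_bij_betw_nat_finite[OF fin] by (auto simp: k_def atLeast0LessThan)
  have t_in: "t \<in> {..<k} \<rightarrow> carrier G"
    using t by (auto simp: bij_betw_def)
  have hom: "group_hom ?F G (word_value G g)" if "g \<in> {..<k} \<rightarrow> carrier G" for g
    using word_value_hom[OF that] by unfold_locales
  have surj: "word_value G t ` carrier ?F = carrier G"
  proof
    show "word_value G t ` carrier ?F \<subseteq> carrier G"
      using group_hom.hom_closed[OF hom[OF t_in]] by blast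
    show "carrier G \<subseteq> word_value G t ` carrier ?F"
    proof
      fix x assume "x \<in> carrier G"
      then obtain i where i: "i < k" "x = t i"
        using t by (auto simp: bij_betw_def)
      then have "x = word_value G t [(i, True)]"
        using \<open>x \<in> carrier G\<close> by (simp add: word_value_def letter_value_def)
      moreover have "[(i, True)] \<in> carrier ?F"
        using i by (simp add: free_group_def reduced_def)
      ultimately show "x \<in> word_value G t ` carrier ?F"
        by blast
    qed
  qed
  \<comment> \<open>Only the values below \<open>k\<close> matter, so extensional functions represent all tuples by a finite set.\<close>
  define I where "I = {g \<in> {..<k} \<rightarrow>\<^sub>E carrier G.
    \<not> (\<exists>\<alpha> \<in> iso G G. \<forall>i<k. g i = \<alpha> (t i))}"
  have "finite I"
    unfolding I_def using fin by (intro finite_subset[OF _ finite_PiE[of "{..<k}" "\<lambda>_. carrier G"]]) auto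
  moreover have "kernel ?F G (word_value G g) \<lhd> ?F" if "g \<in> I" for g
    using that by (intro group_hom.normal_kernel hom) (auto simp: I_def)
  moreover have "\<not> kernel ?F G (word_value G g) \<subseteq> kernel ?F G (word_value G t)" if "g \<in> I" for g
  proof
    assume ker: "kernel ?F G (word_value G g) \<subseteq> kernel ?F G (word_value G t)"
    have "g \<in> {..<k} \<rightarrow> carrier G"
      using that by (auto simp: I_def)
    then obtain \<alpha> where "\<alpha> \<in> iso G G" "\<And>i. i < k \<Longrightarrow> g i = \<alpha> (t i)"
      by (rule automorphism_between_tuples[OF fin _ t_in surj ker]) blast
    then show False
      using that by (auto simp: I_def)
  qed
  ultimately have img: "word_value G t ` (carrier ?F \<inter> (\<Inter>g\<in>I. kernel ?F G (word_value G g)))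
      = carrier G"
    by (rule surj_on_Inter_of_normal_subgroups[OF nonab hom[OF t_in] surj, THEN conjunct2])
  obtain w where w: "w \<in> carrier ?F" "word_value G t w = a"
    and "w \<in> (\<Inter>g\<in>I. kernel ?F G (word_value G g))"
    using a unfolding img[symmetric] by blast
  then have ker: "word_value G g w = \<one>" if "g \<in> I" for g
    using that by (simp add: kernel_def)
  have letters: "fst ` set w \<subseteq> {..<k}"
    using w by (simp add: free_group_def)
  have orbit: "word_value G (\<alpha> \<circ> t) w = \<alpha> a" if "\<alpha> \<in> iso G G" for \<alpha>
    using word_value_hom_image[OF _ t_in letters, of \<alpha>] that w by (simp add: iso_def)
  have "(\<lambda>g. word_value G g w) ` ({..<k} \<rightarrow> carrier G) = {\<one>} \<union> {\<alpha> a | \<alpha>. \<alpha> \<in> iso G G}"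
  proof (intro equalityI subsetI)
    fix x assume "x \<in> (\<lambda>g. word_value G g w) ` ({..<k} \<rightarrow> carrier G)"
    then obtain g where g: "g \<in> {..<k} \<rightarrow> carrier G" and x: "x = word_value G g w"
      by blast
    show "x \<in> {\<one>} \<union> {\<alpha> a | \<alpha>. \<alpha> \<in> iso G G}"
    proof (cases "\<exists>\<alpha> \<in> iso G G. \<forall>i<k. g i = \<alpha> (t i)")
      case True
      then obtain \<alpha> where \<alpha>: "\<alpha> \<in> iso G G" "\<And>i. i < k \<Longrightarrow> g i = \<alpha> (t i)"
        by blast
      then have "x = \<alpha> a"
        unfolding x using word_value_cong[OF _ letters, of g "\<alpha> \<circ> t"] orbit by simp
      then show ?thesis
        using \<alpha> by blast
    next
      case False
      then have "restrict g {..<k} \<in> I"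
        using g by (auto simp: I_def)
      then have "x = \<one>"
        unfolding x using word_value_cong[OF _ letters, of g "restrict g {..<k}"] ker by simp
      then show ?thesis
        by simp
    qed
  next
    fix x assume "x \<in> {\<one>} \<union> {\<alpha> a | \<alpha>. \<alpha> \<in> iso G G}"
    then consider "x = \<one>" | \<alpha> where "\<alpha> \<in> iso G G" "x = \<alpha> a"
      by blast
    then show "x \<in> (\<lambda>g. word_value G g w) ` ({..<k} \<rightarrow> carrier G)"
    proof cases
      case 1
      have "word_value G (\<lambda>_. \<one>) w = \<one>"
        by (induction w) (auto simp: word_value_def letter_value_def)
      then show ?thesis
        using 1 by (intro image_eqI[of _ _ "\<lambda>_. \<one>"]) auto
    next
      case 2
      then show ?thesis
        using orbit[of \<alpha>] t_in
        by (intro image_eqI[of _ _ "\<alpha> \<circ> t"]) (auto simp: iso_def hom_def)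
    qed
  qed
  then show thesis
    by (rule that[OF w(1)])
qed

section \<open>Conjugation in the symmetric group\<close>

text \<open>
  Choose a base point \<open>r x\<close> in each cycle of \<open>a\<close> and reflect the cycle at it: the point that \<open>a\<close>
  reaches from \<open>r x\<close> in \<open>i\<close> steps is exchanged with the point reached in \<open>-i\<close> steps. This
  involution turns \<open>a\<close> around.
\<close>

lemma permutation_conjugate_to_inverse:
  assumes a: "a permutes S" and fin: "finite S"
  obtains s where "s permutes S" "s \<circ> a \<circ> inv' s = inv' a"
proof -
  have "permutation a"
    using a fin permutation_permutes by blast
  then obtain m where m: "a ^^ m = id" "m > 0"
    by (rule permutation_is_nilpotent')
  \<comment> \<open>The power \<open>a ^^ e\<close> is the inverse of \<open>a\<close>, so \<open>i\<close> steps backwards are \<open>i * e\<close> steps forwards.\<close>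
  define e where "e = m - 1"
  have m_eq: "m = e + 1"
    using m(2) by (simp add: e_def)
  have drop_m: "(a ^^ (m * k + l)) x = (a ^^ l) x" for k l x
    by (simp add: funpow_add funpow_mult[symmetric] m(1) id_funpow)
  define orb where "orb x = range (\<lambda>i. (a ^^ i) x)" for x
  have orb_refl: "x \<in> orb x" for x
    unfolding orb_def by (rule range_eqI[of _ _ 0]) simp
  have orb_subset: "orb y \<subseteq> orb x" if "y \<in> orb x" for x y
    using that by (auto simp: orb_def funpow_add[symmetric, THEN fun_cong, simplified])
  have orb_eq: "orb y = orb x" if y: "y \<in> orb x" for x y
  proof (rule equalityI[OF orb_subset[OF y] orb_subset])
    obtain i where i: "y = (a ^^ i) x"
      using y by (auto simp: orb_def)
    have "(a ^^ (e * i)) y = (a ^^ (m * i + 0)) x"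
      unfolding i m_eq by (simp add: funpow_add[symmetric, THEN fun_cong, simplified] algebra_simps)
    also have "\<dots> = x"
      unfolding drop_m by simp
    finally show "x \<in> orb y"
      unfolding orb_def by (metis rangeI)
  qed
  define r where "r x = (SOME y. y \<in> orb x)" for x
  have r: "r x \<in> orb x" for x
    unfolding r_def using orb_refl by (rule someI)
  have r_cong: "r y = r x" if "y \<in> orb x" for x y
    using orb_eq[OF that] by (simp add: r_def)
  have index: "\<exists>i. x = (a ^^ i) (r x)" for x
    using orb_eq[OF r[of x]] orb_refl[of x] by (auto simp: orb_def)
  define s where "s x = (a ^^ ((SOME i. x = (a ^^ i) (r x)) * e)) (r x)" for x
  have s: "s x = (a ^^ (i * e)) (r x)" if x: "x = (a ^^ i) (r x)" for x i
  proof -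
    define j where "j = (SOME j. x = (a ^^ j) (r x))"
    have j: "x = (a ^^ j) (r x)"
      unfolding j_def using index by (rule someI_ex)
    \<comment> \<open>Well-definedness: the indices \<open>i\<close> and \<open>j\<close> of the same point give the same reflected point.\<close>
    have "(a ^^ (j * e)) (r x) = (a ^^ ((i + j) * e)) ((a ^^ i) (r x))"
      unfolding funpow_add[symmetric, THEN fun_cong, simplified]
      using drop_m[of i "j * e"] by (simp add: m_eq algebra_simps)
    also have "\<dots> = (a ^^ ((i + j) * e)) ((a ^^ j) (r x))"
      using x j by simp
    also have "\<dots> = (a ^^ (i * e)) (r x)"
      unfolding funpow_add[symmetric, THEN fun_cong, simplified]
      using drop_m[of j "i * e"] by (simp add: m_eq algebra_simps)
    finally show ?thesis
      by (simp add: s_def j_def)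
  qed
  have s_orb: "r ((a ^^ i) (r x)) = r x" for x i
    using r_cong[of "(a ^^ i) (r x)" "r x"] r_cong[OF r[of x]] by (simp add: orb_def)
  have s_s: "s (s x) = x" for x
  proof -
    obtain i where i: "x = (a ^^ i) (r x)"
      using index by blast
    have "s (s x) = (a ^^ (i * e * e)) (r x)"
      using s[OF i] s[of "s x" "i * e"] s_orb[of "i * e" x] by simp
    also have "\<dots> = (a ^^ (m * i + i * e * e)) (r x)"
      by (simp only: drop_m)
    also have "m * i + i * e * e = m * (i * e) + i"
      by (simp add: m_eq algebra_simps)
    also have "(a ^^ (m * (i * e) + i)) (r x) = x"
      unfolding drop_m using i by simp
    finally show ?thesis .
  qed
  have s_a: "a (s (a x)) = s x" for x
  proof -
    obtain i where i: "x = (a ^^ i) (r x)"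
      using index by blast
    have "r (a x) = r x"
      using rangeI[of "\<lambda>i. (a ^^ i) x" 1] by (intro r_cong) (simp add: orb_def)
    moreover have "a x = (a ^^ Suc i) (r x)"
      using i by simp
    ultimately have "s (a x) = (a ^^ (Suc i * e)) (r x)"
      using s[of "a x" "Suc i"] by simp
    then have "a (s (a x)) = (a ^^ (m * 1 + i * e)) (r x)"
      by (simp add: m_eq funpow_add algebra_simps funpow_swap1)
    also have "\<dots> = s x"
      unfolding drop_m using s[OF i] by simp
    finally show ?thesis .
  qed
  have inv_s: "inv' s = s"
    using s_s by (intro inv_unique_comp) auto
  have "s permutes S"
    unfolding permutes_def
  proof (intro conjI allI impI)
    show "\<exists>!x. s x = y" for y
      using s_s by metis
    fix x assume "x \<notin> S"
    then have ax: "(a ^^ i) x = x" for i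
      by (induction i) (simp_all add: permutes_not_in[OF a])
    then have "r x = x"
      using r[of x] by (simp add: orb_def)
    then show "s x = x"
      using s[of x 0] by simp
  qed
  moreover have "s \<circ> a \<circ> inv' s = inv' a"
  proof
    fix x
    have "a ((s \<circ> a \<circ> inv' s) x) = x"
      using s_a[of "s x"] s_s by (simp add: inv_s)
    then show "(s \<circ> a \<circ> inv' s) x = inv' a x"
      using permutes_inv_eq[OF a] by metis
  qed
  ultimately show thesis
    by (rule that)
qed

text \<open>
  Three transpositions suffice, each one correcting the image of one more point.
\<close>

lemma permutation_with_prescribed_triple:
  assumes "distinct [a, b, c]" "distinct [x, y, z]" "{a, b, c, x, y, z} \<subseteq> S"
  obtains p where "p permutes S" "p a = x" "p b = y" "p c = z"
proof -
  define t1 where "t1 = transpose a x"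
  define t2 where "t2 = transpose (t1 b) y"
  define t3 where "t3 = transpose (t2 (t1 c)) z"
  have t1: "t1 permutes S"
    unfolding t1_def using assms by (intro permutes_swap_id) auto
  have t2: "t2 permutes S"
    unfolding t2_def using assms permutes_in_image[OF t1] by (intro permutes_swap_id) auto
  have t3: "t3 permutes S"
    unfolding t3_def using assms permutes_in_image[OF t1] permutes_in_image[OF t2]
    by (intro permutes_swap_id) auto
  have "t1 a = x"
    by (simp add: t1_def)
  have "t1 b \<noteq> x" "t1 c \<noteq> x" "t1 c \<noteq> t1 b"
    using \<open>t1 a = x\<close> assms(1) inj_eq[OF permutes_inj[OF t1]] by auto
  then have "t2 x = x" "t2 (t1 b) = y"
    using assms(2) by (auto simp: t2_def transpose_def)
  then have "t2 (t1 c) \<noteq> x" "t2 (t1 c) \<noteq> y"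
    using \<open>t1 c \<noteq> x\<close> \<open>t1 c \<noteq> t1 b\<close> inj_eq[OF permutes_inj[OF t2]] by metis+
  then have "t3 x = x" "t3 y = y" "t3 (t2 (t1 c)) = z"
    using assms(2) by (auto simp: t3_def transpose_def)
  with \<open>t1 a = x\<close> \<open>t2 x = x\<close> \<open>t2 (t1 b) = y\<close> show thesis
    by (intro that[of "t3 \<circ> (t2 \<circ> t1)"] permutes_compose t1 t2 t3) auto
qed

text \<open>
  Odd \<open>p\<close> are included: conjugation by all of the symmetric group acts on the alternating group, and
  this is what makes all 3-cycles, and each permutation and its inverse, equivalent.
\<close>

lemma conjugation_iso_alt_group:
  assumes p: "p permutes {1..n}"
  shows "(\<lambda>\<sigma>. p \<circ> \<sigma> \<circ> inv' p) \<in> iso (alt_group n) (alt_group n)"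
proof -
  have conj_closed: "q \<circ> \<sigma> \<circ> inv' q \<in> carrier (alt_group n)"
    if "q permutes {1..n}" "\<sigma> \<in> carrier (alt_group n)" for q \<sigma>
  proof -
    have "permutation q" "permutation \<sigma>"
      using that alt_group_carrier' by (auto simp: permutation_permutes)
    then show ?thesis
      using that by (auto simp: alt_group_carrier evenperm_comp evenperm_inv permutation_inverse
          permutation_compose intro!: permutes_compose permutes_inv)
  qed
  have p': "inv' p permutes {1..n}" "inv' (inv' p) = p"
    using p by (simp_all add: permutes_inv permutes_inv_inv)
  have cancel: "p \<circ> inv' p = id" "inv' p \<circ> p = id"
    using p by (simp_all add: permutes_inv_o)
  have "bij_betw (\<lambda>\<sigma>. p \<circ> \<sigma> \<circ> inv' p) (carrier (alt_group n)) (carrier (alt_group n))"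
    by (rule bij_betw_byWitness[where f' = "\<lambda>\<sigma>. inv' p \<circ> \<sigma> \<circ> p"])
      (use conj_closed[OF p] conj_closed[OF p'(1)] p'(2) cancel in
        \<open>auto simp: fun_eq_iff\<close>)
  moreover have "(\<lambda>\<sigma>. p \<circ> \<sigma> \<circ> inv' p) \<in> hom (alt_group n) (alt_group n)"
    using conj_closed[OF p] cancel by (auto intro!: homI simp: alt_group_mult fun_eq_iff)
  ultimately show ?thesis
    by (simp add: iso_def)
qed

section \<open>Simplicity of the alternating groups\<close>

lemma inv_three_cycle:
  assumes "distinct [a, b, c]"
  shows "inv' (cycle_of_list [a, b, c]) = cycle_of_list [c, b, a]"
  by (rule inv_unique_comp) (use assms in \<open>auto simp: fun_eq_iff transpose_def\<close>)

lemma three_cycle_in_alt_group: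
  assumes "distinct [a, b, c]" "{a, b, c} \<subseteq> {1..n}"
  shows "cycle_of_list [a, b, c] \<in> carrier (alt_group n)"
proof (rule subsetD[OF three_cycles_incl], intro CollectI exI conjI)
  show "cycle_of_list [a, b, c] = cycle_of_list [a, b, c]" ..
qed (use assms in auto)

text \<open>
  For a nontrivial normal subgroup of \<open>Alt(n)\<close>, \<open>n \<ge> 5\<close>, the classical argument applies: commutators
  of its elements with suitable 3-cycles move few points and eventually yield a 3-cycle; all 3-cycles
  are conjugate; and 3-cycles generate \<open>Alt(n)\<close>.
\<close>

locale normal_in_alt_group = normal N "alt_group n" for N n
begin

definition contains_some_three_cycle :: bool where
  "contains_some_three_cycle \<longleftrightarrow>
     (\<exists>a b c. distinct [a, b, c] \<and> {a, b, c} \<subseteq> {1..n} \<and> cycle_of_list [a, b, c] \<in> N)"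

lemma contains_some_three_cycleI:
  assumes "cycle_of_list [a, b, c] \<in> N" "distinct [a, b, c]" "{a, b, c} \<subseteq> {1..n}"
  shows contains_some_three_cycle
  unfolding contains_some_three_cycle_def using assms by (intro exI conjI)

lemma permutes: "\<sigma> \<in> N \<Longrightarrow> \<sigma> permutes {1..n}"
  using mem_carrier by (auto simp: alt_group_carrier)

lemma conjugate_closed:
  assumes "q \<in> carrier (alt_group n)" "\<sigma> \<in> N"
  shows "q \<circ> \<sigma> \<circ> inv' q \<in> N"
  using inv_op_closed2[OF assms] assms(1) by (simp add: alt_group_mult alt_group_inv_equality)

text \<open>
  This is the commutator of \<open>\<sigma>\<close> with \<open>(a b c)\<close>: conjugating the 3-cycle by \<open>\<sigma>\<close> relabels its points,
  and its inverse is the reversed cycle.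
\<close>

lemma commutator_with_three_cycle:
  assumes \<sigma>: "\<sigma> \<in> N" and d: "distinct [a, b, c]" and sub: "{a, b, c} \<subseteq> {1..n}"
  shows "cycle_of_list [\<sigma> a, \<sigma> b, \<sigma> c] \<circ> cycle_of_list [c, b, a] \<in> N"
proof -
  define \<tau> where "\<tau> = cycle_of_list [a, b, c]"
  have "\<tau> \<in> carrier (alt_group n)"
    unfolding \<tau>_def by (rule three_cycle_in_alt_group[OF d sub])
  moreover have "inv' \<sigma> \<in> N"
    using subgroup.m_inv_closed[OF subgroup_axioms \<sigma>] mem_carrier[OF \<sigma>] by (simp add: alt_group_inv_equality)
  ultimately have "\<tau> \<circ> inv' \<sigma> \<circ> inv' \<tau> \<in> N"
    by (rule conjugate_closed)
  then have "\<sigma> \<circ> (\<tau> \<circ> inv' \<sigma> \<circ> inv' \<tau>) \<in> N"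
    using subgroup.m_closed[OF subgroup_axioms \<sigma>] by (simp add: alt_group_mult)
  moreover have "\<sigma> \<circ> \<tau> \<circ> inv' \<sigma> = cycle_of_list [\<sigma> a, \<sigma> b, \<sigma> c]"
    unfolding \<tau>_def using conjugation_of_cycle[OF d permutes_bij[OF permutes[OF \<sigma>]]] by simp
  ultimately show ?thesis
    by (simp only: o_assoc inv_three_cycle[OF d, folded \<tau>_def])
qed

lemma three_cycle_if_four_in_a_row:
  assumes \<sigma>: "\<sigma> \<in> N" and "\<sigma> a = b" "\<sigma> b = c" "\<sigma> c = d"
    and d: "distinct [a, b, c, d]" and "{a, b, c, d} \<subseteq> {1..n}"
  shows contains_some_three_cycle
proof -
  have "cycle_of_list [\<sigma> a, \<sigma> b, \<sigma> c] \<circ> cycle_of_list [c, b, a] \<in> N"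
    by (rule commutator_with_three_cycle[OF \<sigma>]) (use assms in auto)
  also have "cycle_of_list [\<sigma> a, \<sigma> b, \<sigma> c] \<circ> cycle_of_list [c, b, a] = cycle_of_list [a, d, b]"
  proof
    fix x
    show "(cycle_of_list [\<sigma> a, \<sigma> b, \<sigma> c] \<circ> cycle_of_list [c, b, a]) x = cycle_of_list [a, d, b] x"
      unfolding assms(2-4) using d by (cases "x \<in> {a, b, c, d}") (auto simp: transpose_def)
  qed
  finally show ?thesis
    by (rule contains_some_three_cycleI) (use assms in auto)
qed

text \<open>
  The commutator of \<open>\<sigma>\<close> with \<open>(a b d)\<close> is the 5-cycle \<open>(a d c e b)\<close>, to which the previous lemma
  applies.
\<close>

lemma three_cycle_if_three_cycle_and_more:
  assumes \<sigma>: "\<sigma> \<in> N" and "\<sigma> a = b" "\<sigma> b = c" "\<sigma> c = a" "\<sigma> d = e"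
    and d: "distinct [a, b, c, d, e]" and "{a, b, c, d, e} \<subseteq> {1..n}"
  shows contains_some_three_cycle
proof -
  define \<rho> where "\<rho> = cycle_of_list [b, c, e] \<circ> cycle_of_list [d, b, a]"
  have "\<rho> \<in> N"
    unfolding \<rho>_def using commutator_with_three_cycle[OF \<sigma>, of a b d] assms by simp
  moreover have "\<rho> a = d" "\<rho> d = c" "\<rho> c = e"
    using d by (auto simp: \<rho>_def transpose_def)
  ultimately show ?thesis
    by (rule three_cycle_if_four_in_a_row) (use assms in auto)
qed

text \<open>
  Conjugation by \<open>\<sigma>\<close> inverts \<open>(a b e)\<close>, so the commutator is the square of a 3-cycle.
\<close>

lemma three_cycle_if_swap_and_fixed_point:
  assumes \<sigma>: "\<sigma> \<in> N" and "\<sigma> a = b" "\<sigma> b = a" "\<sigma> e = e"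
    and d: "distinct [a, b, e]" and "{a, b, e} \<subseteq> {1..n}"
  shows contains_some_three_cycle
proof -
  have "cycle_of_list [\<sigma> a, \<sigma> b, \<sigma> e] \<circ> cycle_of_list [e, b, a] \<in> N"
    by (rule commutator_with_three_cycle[OF \<sigma>]) (use assms in auto)
  also have "cycle_of_list [\<sigma> a, \<sigma> b, \<sigma> e] \<circ> cycle_of_list [e, b, a] = cycle_of_list [a, b, e]"
    unfolding assms(2-4) using d by (auto simp: fun_eq_iff transpose_def)
  finally show ?thesis
    by (rule contains_some_three_cycleI) (use assms in auto)
qed

text \<open>
  If \<open>\<sigma>\<close> moves a third point \<open>e\<close> to \<open>e'\<close>, its commutator with \<open>(a b e)\<close> is \<open>(a e)(b e')\<close>. Here
  \<open>n \<ge> 5\<close> enters: a fifth point remains, and this element fixes it.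
\<close>

lemma three_cycle_if_two_swapped_points:
  assumes n: "n \<ge> 5" and \<sigma>: "\<sigma> \<in> N" and "\<sigma> a = b" "\<sigma> b = a" "a \<noteq> b" "{a, b} \<subseteq> {1..n}"
  shows contains_some_three_cycle
proof -
  have "\<not> {1..n} \<subseteq> {a, b}"
    using n card_mono[of "{a, b}" "{1..n}"] by (auto simp: card_insert_if split: if_splits)
  then obtain e where e: "e \<in> {1..n}" "e \<notin> {a, b}"
    by blast
  define e' where "e' = \<sigma> e"
  have e': "e' \<in> {1..n}"
    unfolding e'_def using e(1) permutes_in_image[OF permutes[OF \<sigma>]] by blast
  show ?thesis
  proof (cases "e' = e")
    case True
    then show ?thesis
      using three_cycle_if_swap_and_fixed_point[OF \<sigma>, of a b e] assms e by (auto simp: e'_def)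
  next
    case False
    have "e' \<noteq> a" "e' \<noteq> b"
      using assms e injD[OF permutes_inj[OF permutes[OF \<sigma>]], of e] by (auto simp: e'_def)
    have "\<not> {1..n} \<subseteq> {a, b, e, e'}"
      using n card_mono[of "{a, b, e, e'}" "{1..n}"] by (auto simp: card_insert_if split: if_splits)
    then obtain f where f: "f \<in> {1..n}" "f \<notin> {a, b, e, e'}"
      by blast
    define \<rho> where "\<rho> = cycle_of_list [b, a, e'] \<circ> cycle_of_list [e, b, a]"
    have "\<rho> \<in> N"
      unfolding \<rho>_def using commutator_with_three_cycle[OF \<sigma>, of a b e] assms e
      by (simp add: e'_def)
    moreover have "\<rho> a = e" "\<rho> e = a" "\<rho> f = f"
      using assms e f False \<open>e' \<noteq> a\<close> \<open>e' \<noteq> b\<close> by (auto simp: \<rho>_def transpose_def)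
    ultimately show ?thesis
      by (rule three_cycle_if_swap_and_fixed_point) (use assms e f in auto)
  qed
qed

lemma contains_three_cycle:
  assumes n: "n \<ge> 5" and \<sigma>: "\<sigma> \<in> N" "\<sigma> \<noteq> id"
  shows contains_some_three_cycle
proof -
  have perm: "\<sigma> permutes {1..n}"
    by (rule permutes[OF \<sigma>(1)])
  have inj: "x = y" if "\<sigma> x = \<sigma> y" for x y
    using injD[OF permutes_inj[OF perm] that] .
  have in_range: "\<sigma> x \<in> {1..n}" if "x \<in> {1..n}" for x
    using that permutes_in_image[OF perm] by blast
  obtain a where a: "\<sigma> a \<noteq> a"
    using \<sigma>(2) by (auto simp: fun_eq_iff)
  then have a_in: "a \<in> {1..n}"
    using permutes_not_in[OF perm] by blast
  define b c d where "b = \<sigma> a" and "c = \<sigma> b" and "d = \<sigma> c"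
  note defs = b_def c_def d_def
  have sub: "{a, b, c, d} \<subseteq> {1..n}"
    using a_in in_range by (auto simp: defs)
  have "b \<noteq> a" "c \<noteq> b"
    using a inj by (auto simp: defs)
  show ?thesis
  proof (cases "c = a")
    case True
    then show ?thesis
      using three_cycle_if_two_swapped_points[OF n \<sigma>(1), of a b] \<open>b \<noteq> a\<close> sub
      by (auto simp: defs)
  next
    case False
    have "d \<noteq> b" "d \<noteq> c"
      using False \<open>c \<noteq> b\<close> inj by (auto simp: defs)
    show ?thesis
    proof (cases "d = a")
      case False
      then show ?thesis
        using three_cycle_if_four_in_a_row[OF \<sigma>(1), of a b c d] \<open>c \<noteq> a\<close> \<open>b \<noteq> a\<close> \<open>c \<noteq> b\<close>
          \<open>d \<noteq> b\<close> \<open>d \<noteq> c\<close> sub by (auto simp: defs)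
    next
      case True
      have cyc: "\<sigma> a = b" "\<sigma> b = c" "\<sigma> c = a"
        using True by (simp_all add: defs)
      show ?thesis
      proof (cases "\<exists>x. x \<notin> {a, b, c} \<and> \<sigma> x \<noteq> x")
        case True
        then obtain x where x: "x \<notin> {a, b, c}" "\<sigma> x \<noteq> x"
          by blast
        then have "x \<in> {1..n}"
          using permutes_not_in[OF perm] by blast
        moreover have "\<sigma> x \<notin> {a, b, c}"
          using x cyc inj by (metis insert_iff empty_iff)
        ultimately show ?thesis
          using three_cycle_if_three_cycle_and_more[OF \<sigma>(1) cyc refl, of x] x in_range
            \<open>c \<noteq> a\<close> \<open>b \<noteq> a\<close> \<open>c \<noteq> b\<close> sub by auto
      next
        case False
        have "\<sigma> x = cycle_of_list [a, b, c] x" for x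
          using False cyc \<open>c \<noteq> a\<close> \<open>b \<noteq> a\<close> \<open>c \<noteq> b\<close> by (cases "x \<in> {a, b, c}") (auto simp: transpose_def)
        then have "\<sigma> = cycle_of_list [a, b, c]"
          by blast
        with \<sigma>(1) have "cycle_of_list [a, b, c] \<in> N"
          by (simp only:)
        then show ?thesis
          by (rule contains_some_three_cycleI)
            (use \<open>c \<noteq> a\<close> \<open>b \<noteq> a\<close> \<open>c \<noteq> b\<close> sub in auto)
      qed
    qed
  qed
qed

text \<open>
  Some permutation conjugates the given 3-cycle to the wanted one. If it is odd, it is corrected by a
  transposition of two points that the given cycle fixes; \<open>n \<ge> 5\<close> provides them.
\<close>

lemma contains_all_three_cycles:
  assumes n: "n \<ge> 5" and contains_some_three_cycle
    and xyz: "distinct [x, y, z]" "{x, y, z} \<subseteq> {1..n}"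
  shows "cycle_of_list [x, y, z] \<in> N"
proof -
  obtain a b c where abc: "distinct [a, b, c]" "{a, b, c} \<subseteq> {1..n}"
    and in_N: "cycle_of_list [a, b, c] \<in> N"
    using assms(2) unfolding contains_some_three_cycle_def by (elim exE conjE)
  obtain p where p: "p permutes {1..n}" "p a = x" "p b = y" "p c = z"
    by (rule permutation_with_prescribed_triple[OF abc(1) xyz(1), of "{1..n}"])
      (use abc xyz in auto)
  have "card {a, b, c} = 3"
    using abc(1) by simp
  then have "card ({1..n} - {a, b, c}) \<ge> 2"
    using n abc(2) by (subst card_Diff_subset) auto
  then obtain d e where de: "{d, e} \<subseteq> {1..n} - {a, b, c}" "d \<noteq> e"
    by (metis card_2_iff obtain_subset_with_card_n)
  define q where "q = (if evenperm p then p else p \<circ> transpose d e)"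
  have "transpose d e permutes {1..n}"
    using de by (intro permutes_swap_id) auto
  moreover have "permutation p"
    using p(1) permutation_permutes by blast
  ultimately have q: "q \<in> carrier (alt_group n)"
    using p(1) de(2) by (auto simp: q_def alt_group_carrier evenperm_comp permutation_swap_id
        evenperm_swap intro: permutes_compose)
  have "q a = x" "q b = y" "q c = z"
    using p de by (auto simp: q_def transpose_def)
  moreover have "bij q"
    using q by (auto simp: alt_group_carrier dest: permutes_bij)
  ultimately have "q \<circ> cycle_of_list [a, b, c] \<circ> inv' q = cycle_of_list [x, y, z]"
    using conjugation_of_cycle[OF abc(1), of q] by (simp only: list.map)
  then show ?thesis
    using conjugate_closed[OF q in_N] by (simp only:)
qed

end

theorem alt_group_simple:
  assumes n: "n \<ge> 5"
  shows "simple_group (alt_group n)"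
proof -
  interpret A: group "alt_group n"
    by (rule alt_group_is_group)
  show ?thesis
  proof
    have "fact 5 \<le> (fact n :: nat)"
      by (rule fact_mono_nat[OF n])
    then show "1 < order (alt_group n)"
      using alt_group_card_carrier[of n] n by (simp add: order_def fact_numeral)
  next
    fix N assume N: "N \<lhd> alt_group n"
    then interpret normal_in_alt_group N n
      by (simp add: normal_in_alt_group_def)
    show "N = carrier (alt_group n) \<or> N = {\<one>\<^bsub>alt_group n\<^esub>}"
    proof (cases "N \<subseteq> {id}")
      case True
      then show ?thesis
        using subgroup.one_closed[OF subgroup_axioms] by (auto simp: alt_group_one)
    next
      case False
      then have some: contains_some_three_cycle
        using contains_three_cycle[OF n] by blast
      have "three_cycles n \<subseteq> N"
      proof
        fix \<tau> assume "\<tau> \<in> three_cycles n"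
        then obtain cs where cs: "\<tau> = cycle_of_list cs" "cycle cs" "length cs = 3" "set cs \<subseteq> {1..n}"
          by blast
        obtain x y z where "cs = [x, y, z]"
          using stupid_lemma[OF cs(3)] by blast
        then show "\<tau> \<in> N"
          using contains_all_three_cycles[OF n some, of x y z] cs by simp
      qed
      then have "carrier (alt_group n) \<subseteq> N"
        unfolding alt_group_carrier_as_three_cycles
        by (rule A.generate_subgroup_incl) (rule subgroup_axioms)
      then show ?thesis
        using subset by blast
    qed
  qed
qed

lemma alt_group_not_comm:
  assumes n: "n \<ge> 5"
  shows "\<not> comm_group (alt_group n)"
proof
  assume "comm_group (alt_group n)"
  then interpret comm_group "alt_group n" .
  have "cycle_of_list [1, 2, c] \<in> carrier (alt_group n)" if "c \<in> {3, 4}" for c :: nat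
    by (rule three_cycle_in_alt_group) (use that n in auto)
  from m_comm[OF this this, of 3 4]
  have "cycle_of_list [1, 2, 3] \<circ> cycle_of_list [1, 2, 4]
      = cycle_of_list [1, 2, 4] \<circ> cycle_of_list [1, 2, 3 :: nat]"
    by (simp only: alt_group_mult insert_iff simp_thms)
  from fun_cong[OF this, of 1] show False
    by (simp add: transpose_def)
qed

section \<open>Alternating groups of degree at most four\<close>

text \<open>
  The power word \<open>x\<^sub>0\<^sup>m\<close> has the values \<open>g\<^sup>m\<close>. It realises \<open>C\<close> as soon as \<open>m\<close>-th powers fix \<open>C\<close>
  pointwise and map everything into \<open>{\<one>} \<union> C\<close>.
\<close>

lemma (in group) power_word_values:
  fixes m :: nat
  assumes C: "C \<subseteq> carrier G"
    and fixed: "\<And>c. c \<in> C \<Longrightarrow> c [^] m = c"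
    and into: "\<And>g. g \<in> carrier G \<Longrightarrow> g [^] m \<in> {\<one>} \<union> C"
  obtains k w where "w \<in> carrier (free_group k)"
    "(\<lambda>g. word_value G g w) ` ({..<k} \<rightarrow> carrier G) = {\<one>} \<union> C"
proof -
  let ?w = "replicate m (0, True)"
  have "reduced ?w"
  proof (induction m)
    case (Suc m)
    then show ?case
      by (cases m) (auto simp: reduced_def inv_letter_def)
  qed simp
  then have w: "?w \<in> carrier (free_group 1)"
    by (auto simp: free_group_def)
  have word_value_w: "word_value G g ?w = g 0 [^] m" if "g \<in> {..<1} \<rightarrow> carrier G" for g
  proof -
    have "g 0 \<in> carrier G"
      using that by auto
    then show ?thesis
    proof (induction m)
      case (Suc m)
      have "word_value G g (replicate (Suc m) (0, True)) = g 0 \<otimes> g 0 [^] m"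
        using Suc by (simp add: word_value_def letter_value_def)
      also have "\<dots> = g 0 [^] Suc m"
        using Suc.prems by (rule nat_pow_Suc2[symmetric])
      finally show ?case .
    qed (simp add: word_value_def)
  qed
  have "(\<lambda>g. word_value G g ?w) ` ({..<1} \<rightarrow> carrier G) = {\<one>} \<union> C"
  proof (intro equalityI subsetI)
    fix x assume "x \<in> (\<lambda>g. word_value G g ?w) ` ({..<1} \<rightarrow> carrier G)"
    then obtain g where g: "g \<in> {..<1} \<rightarrow> carrier G" "x = word_value G g ?w"
      by blast
    then have "g 0 \<in> carrier G"
      by auto
    then show "x \<in> {\<one>} \<union> C"
      using into g word_value_w by simp
  next
    fix x assume "x \<in> {\<one>} \<union> C"
    then have "x \<in> carrier G" "x [^] m = x"
      using C fixed by auto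
    then show "x \<in> (\<lambda>g. word_value G g ?w) ` ({..<1} \<rightarrow> carrier G)"
      using word_value_w[of "\<lambda>_. x"] by (intro image_eqI[of _ _ "\<lambda>_. x"]) auto
  qed
  then show thesis
    by (rule that[OF w])
qed

lemma alt_group_pow: "x [^]\<^bsub>alt_group n\<^esub> (m :: nat) = x ^^ m"
proof (induction m)
  case (Suc m)
  then show ?case
    by (simp add: nat_pow_def alt_group_mult funpow_Suc_right del: funpow.simps)
qed (simp add: nat_pow_def alt_group_one)

lemma conjugation_of_double_transposition:
  assumes "bij p" "a \<noteq> b" "c \<noteq> d"
  shows "p \<circ> (transpose a b \<circ> transpose c d) \<circ> inv' p = transpose (p a) (p b) \<circ> transpose (p c) (p d)"
proof -
  have "p \<circ> (transpose a b \<circ> transpose c d) \<circ> inv' p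
      = (p \<circ> transpose a b \<circ> inv' p) \<circ> (p \<circ> transpose c d \<circ> inv' p)"
    by (simp add: fun_eq_iff inv_f_f[OF bij_is_inj[OF assms(1)]])
  then show ?thesis
    using conjugation_of_cycle[of "[a, b]" p] conjugation_of_cycle[of "[c, d]" p] assms by simp
qed

lemma conjugate_in_orbit:
  assumes "p permutes {1..n}" "p \<circ> \<sigma> \<circ> inv' p = \<tau>"
  shows "\<tau> \<in> {\<alpha> \<sigma> | \<alpha>. \<alpha> \<in> iso (alt_group n) (alt_group n)}"
proof (intro CollectI exI conjI)
  show "(\<lambda>\<sigma>. p \<circ> \<sigma> \<circ> inv' p) \<in> iso (alt_group n) (alt_group n)"
    by (rule conjugation_iso_alt_group[OF assms(1)])
qed (simp add: assms(2))

text \<open>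
  Follow a moved point \<open>a\<close> along its cycle. With at most four points available, the only alternatives
  to the two listed types are a single transposition and a 4-cycle, and both are odd.
\<close>

lemma alt_group_small_cases:
  assumes n: "n < 5" and \<sigma>: "\<sigma> \<in> carrier (alt_group n)" "\<sigma> \<noteq> id"
  obtains (three_cycle) a b c where "distinct [a, b, c]" "{a, b, c} \<subseteq> {1..n}"
      "\<sigma> = cycle_of_list [a, b, c]"
    | (double_transposition) a b c d where "distinct [a, b, c, d]" "{a, b, c, d} = {1..n}"
      "\<sigma> = transpose a b \<circ> transpose c d"
proof -
  have perm: "\<sigma> permutes {1..n}" and even: "evenperm \<sigma>"
    using \<sigma>(1) by (auto simp: alt_group_carrier)
  note inj = inj_eq[OF permutes_inj[OF perm]]
  have in_range: "\<sigma> x \<in> {1..n}" if "x \<in> {1..n}" for x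
    using that permutes_in_image[OF perm] by blast
  have moved: "x \<in> {1..n}" if "\<sigma> x \<noteq> x" for x
    using that permutes_not_in[OF perm] by blast
  have four_points: "set xs = {1..n}" if "distinct xs" "length xs \<ge> 4" "set xs \<subseteq> {1..n}" for xs
  proof (rule card_seteq[OF _ that(3)])
    show "card {1..n} \<le> card (set xs)"
      using n that by (simp add: distinct_card)
  qed simp
  obtain a where a: "\<sigma> a \<noteq> a"
    using \<sigma>(2) by (auto simp: fun_eq_iff)
  have a_in: "a \<in> {1..n}"
    by (rule moved[OF a])
  define b c d where "b = \<sigma> a" and "c = \<sigma> b" and "d = \<sigma> c"
  note defs = b_def c_def d_def
  have sub: "{a, b, c, d} \<subseteq> {1..n}"
    using a_in in_range by (auto simp: defs)
  have "b \<noteq> a" "c \<noteq> b"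
    using a inj by (auto simp: defs)
  show thesis
  proof (cases "c = a")
    case True
    have "\<exists>x. x \<notin> {a, b} \<and> \<sigma> x \<noteq> x"
    proof (rule ccontr)
      assume "\<not> ?thesis"
      then have "\<sigma> = transpose a b"
        using True by (auto simp: fun_eq_iff transpose_def defs)
      then show False
        using even \<open>b \<noteq> a\<close> by (simp add: evenperm_swap)
    qed
    then obtain x where x: "x \<notin> {a, b}" "\<sigma> x \<noteq> x"
      by blast
    have x_in: "x \<in> {1..n}"
      by (rule moved[OF x(2)])
    have cyc: "\<sigma> a = b" "\<sigma> b = a"
      using True by (simp_all add: defs)
    have "\<sigma> x \<noteq> a" "\<sigma> x \<noteq> b"
      using x cyc inj by (metis insert_iff)+
    then have four: "distinct [a, b, x, \<sigma> x]"
      using x \<open>b \<noteq> a\<close> by auto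
    then have all: "{a, b, x, \<sigma> x} = {1..n}"
      using four_points[of "[a, b, x, \<sigma> x]"] sub x_in in_range by simp
    have "\<sigma> (\<sigma> x) \<in> {a, b, x, \<sigma> x}"
      using all in_range x_in by blast
    moreover have "\<sigma> (\<sigma> x) \<noteq> a" "\<sigma> (\<sigma> x) \<noteq> b" "\<sigma> (\<sigma> x) \<noteq> \<sigma> x"
      using four cyc inj x by (metis distinct_length_2_or_more)+
    ultimately have "\<sigma> (\<sigma> x) = x"
      by blast
    have "\<sigma> = transpose a b \<circ> transpose x (\<sigma> x)"
    proof
      fix y show "\<sigma> y = (transpose a b \<circ> transpose x (\<sigma> x)) y"
      proof (cases "y \<in> {a, b, x, \<sigma> x}")
        case True
        then show ?thesis
          using four cyc \<open>\<sigma> (\<sigma> x) = x\<close> by (auto simp: transpose_def)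
      next
        case False
        then have "\<sigma> y = y"
          unfolding all by (rule permutes_not_in[OF perm])
        then show ?thesis
          using False by (simp add: transpose_def)
      qed
    qed
    then show thesis
      by (rule double_transposition[OF four all])
  next
    case False
    then have abc: "distinct [a, b, c]"
      using \<open>b \<noteq> a\<close> \<open>c \<noteq> b\<close> by auto
    have "d \<noteq> b" "d \<noteq> c"
      using False \<open>c \<noteq> b\<close> inj by (auto simp: defs)
    have "d = a"
    proof (rule ccontr)
      assume "d \<noteq> a"
      then have four: "distinct [a, b, c, d]"
        using abc \<open>d \<noteq> b\<close> \<open>d \<noteq> c\<close> by auto
      then have all: "{a, b, c, d} = {1..n}"
        using four_points[of "[a, b, c, d]"] sub by simp
      have "\<sigma> d \<in> {a, b, c, d}"
        using all in_range sub by blast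
      moreover have "\<sigma> d \<noteq> b" "\<sigma> d \<noteq> c" "\<sigma> d \<noteq> d"
        using four inj by (auto simp: defs)
      ultimately have "\<sigma> d = a"
        by blast
      have "\<sigma> = transpose a b \<circ> transpose b c \<circ> transpose c d"
      proof
        fix y show "\<sigma> y = (transpose a b \<circ> transpose b c \<circ> transpose c d) y"
        proof (cases "y \<in> {a, b, c, d}")
          case True
          then show ?thesis
            using four \<open>\<sigma> d = a\<close> b_def[symmetric] c_def[symmetric] d_def[symmetric]
            by (auto simp: transpose_def)
        next
          case False
          then have "\<sigma> y = y"
            unfolding all by (rule permutes_not_in[OF perm])
          then show ?thesis
            using False by (simp add: transpose_def)
        qed
      qed
      then show False
        using even four
        by (simp add: evenperm_comp evenperm_swap permutation_swap_id permutation_compose)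
    qed
    then have cyc: "\<sigma> a = b" "\<sigma> b = c" "\<sigma> c = a"
      by (simp_all add: defs)
    have others: "\<sigma> x = x" if "x \<notin> {a, b, c}" for x
    proof (rule ccontr)
      assume x: "\<sigma> x \<noteq> x"
      have "\<sigma> x \<notin> {a, b, c}"
        using that cyc inj by (metis insert_iff empty_iff)
      then have five: "distinct [a, b, c, x, \<sigma> x]"
        using abc that x by auto
      then have "set [a, b, c, x, \<sigma> x] \<subseteq> {1..n}"
        using sub moved[OF x] in_range by auto
      from card_mono[OF _ this] show False
        using n distinct_card[OF five] by simp
    qed
    have "\<sigma> = cycle_of_list [a, b, c]"
    proof
      fix x show "\<sigma> x = cycle_of_list [a, b, c] x"
        using others[of x] cyc abc by (cases "x \<in> {a, b, c}") (auto simp: transpose_def)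
    qed
    from three_cycle[OF abc _ this] show thesis
      using sub by blast
  qed
qed

lemma three_cycle_cubed: "distinct [a, b, c] \<Longrightarrow> cycle_of_list [a, b, c] ^^ 3 = id"
  using cycle_is_id_root[of "[a, b, c]"] by (simp add: numeral_eq_Suc del: cycle_of_list.simps)

lemma double_transposition_squared:
  assumes "distinct [a, b, c, d]"
  shows "(transpose a b \<circ> transpose c d) ^^ 2 = id"
proof
  fix x show "((transpose a b \<circ> transpose c d) ^^ 2) x = id x"
    using assms by (cases "x \<in> {a, b, c, d}") (auto simp: numeral_2_eq_2 transpose_def)
qed

lemma funpow_of_small_order:
  fixes f :: "'a \<Rightarrow> 'a"
  shows "f ^^ 3 = id \<Longrightarrow> f ^^ 4 = f" "f ^^ 2 = id \<Longrightarrow> f ^^ 3 = f" "f ^^ 2 = id \<Longrightarrow> f ^^ 4 = id"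
  by (simp_all add: numeral_eq_Suc)

text \<open>
  All 3-cycles are equivalent and so are all double transpositions; automorphisms preserve the order
  of an element. Hence \<open>x\<^sub>0\<^sup>4\<close>, which fixes 3-cycles and kills double transpositions, and \<open>x\<^sub>0\<^sup>3\<close>,
  which does the opposite, realise the two nontrivial types of classes.
\<close>

lemma word_for_orbit_in_small_alt_group:
  assumes n: "n < 5" and \<sigma>: "\<sigma> \<in> carrier (alt_group n)"
  defines "C \<equiv> {\<alpha> \<sigma> | \<alpha>. \<alpha> \<in> iso (alt_group n) (alt_group n)}"
  obtains k w where "w \<in> carrier (free_group k)"
    "(\<lambda>g. word_value (alt_group n) g w) ` ({..<k} \<rightarrow> carrier (alt_group n))
       = {\<one>\<^bsub>alt_group n\<^esub>} \<union> C"
proof -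
  interpret A: group "alt_group n"
    by (rule alt_group_is_group)
  have C: "C \<subseteq> carrier (alt_group n)"
    using \<sigma> by (auto simp: C_def iso_def hom_def)
  have C_pow: "c [^]\<^bsub>alt_group n\<^esub> m = c" if m: "\<sigma> ^^ m = \<sigma>" and "c \<in> C" for c and m :: nat
  proof -
    obtain \<alpha> where \<alpha>: "\<alpha> \<in> iso (alt_group n) (alt_group n)" "c = \<alpha> \<sigma>"
      using \<open>c \<in> C\<close> by (auto simp: C_def)
    interpret \<alpha>: group_hom "alt_group n" "alt_group n" \<alpha>
      using \<alpha> by unfold_locales (simp add: iso_def)
    show ?thesis
      using \<alpha>.hom_nat_pow[OF \<sigma>, of m] m \<alpha>(2) by (simp add: alt_group_pow)
  qed
  show thesis
  proof (cases "\<sigma> = id")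
    case True
    have one: "\<alpha> id = id" if "\<alpha> \<in> iso (alt_group n) (alt_group n)" for \<alpha>
      using hom_one[of \<alpha> "alt_group n" "alt_group n"] that A.group_axioms
      by (simp add: iso_def alt_group_one)
    show thesis
    proof (rule A.power_word_values[OF C, of 0])
      show "c [^]\<^bsub>alt_group n\<^esub> (0::nat) = c" if "c \<in> C" for c
        using that one by (auto simp: C_def True alt_group_one)
    qed (use that in auto)
  next
    case False
    from n \<sigma> False show thesis
    proof (cases rule: alt_group_small_cases)
      case (three_cycle a b c)
      have \<sigma>4: "\<sigma> ^^ 4 = \<sigma>"
        unfolding three_cycle(3) by (intro funpow_of_small_order three_cycle_cubed three_cycle(1))
      show thesis
      proof (rule A.power_word_values[OF C, of 4])
        fix g assume g: "g \<in> carrier (alt_group n)"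
        show "g [^]\<^bsub>alt_group n\<^esub> (4::nat) \<in> {\<one>\<^bsub>alt_group n\<^esub>} \<union> C"
        proof (cases "g = id")
          case False
          with n g show ?thesis
          proof (cases rule: alt_group_small_cases)
            case t: (three_cycle x y z)
            obtain p where p: "p permutes {1..n}" "p a = x" "p b = y" "p c = z"
              by (rule permutation_with_prescribed_triple[OF three_cycle(1) t(1), of "{1..n}"])
                (use three_cycle(2) t(2) in auto)
            have "p \<circ> \<sigma> \<circ> inv' p = g"
              using conjugation_of_cycle[OF three_cycle(1) permutes_bij[OF p(1)]] p
              unfolding three_cycle(3) t(3) by (simp only: list.map)
            then have "g \<in> C"
              unfolding C_def by (rule conjugate_in_orbit[OF p(1)])
            moreover have "g ^^ 4 = g"
              unfolding t(3) by (intro funpow_of_small_order three_cycle_cubed t(1))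
            ultimately show ?thesis
              by (simp add: alt_group_pow)
          next
            case t: (double_transposition x y z u)
            have "g ^^ 4 = id"
              unfolding t(3) by (intro funpow_of_small_order double_transposition_squared t(1))
            then show ?thesis
              by (simp add: alt_group_pow alt_group_one)
          qed
        qed (simp add: alt_group_pow alt_group_one)
      qed (use that C_pow[OF \<sigma>4] in auto)
    next
      case (double_transposition a b c d)
      have \<sigma>3: "\<sigma> ^^ 3 = \<sigma>"
        unfolding double_transposition(3)
        by (intro funpow_of_small_order double_transposition_squared double_transposition(1))
      show thesis
      proof (rule A.power_word_values[OF C, of 3])
        fix g assume g: "g \<in> carrier (alt_group n)"
        show "g [^]\<^bsub>alt_group n\<^esub> (3::nat) \<in> {\<one>\<^bsub>alt_group n\<^esub>} \<union> C"
        proof (cases "g = id")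
          case False
          with n g show ?thesis
          proof (cases rule: alt_group_small_cases)
            case t: (three_cycle x y z)
            have "g ^^ 3 = id"
              unfolding t(3) by (rule three_cycle_cubed[OF t(1)])
            then show ?thesis
              by (simp add: alt_group_pow alt_group_one)
          next
            case t: (double_transposition x y z u)
            obtain p where p: "p permutes {1..n}" "p a = x" "p b = y" "p c = z"
              by (rule permutation_with_prescribed_triple[of a b c x y z "{1..n}"])
                (use double_transposition t in auto)
            \<comment> \<open>The images of three of the four points determine the image of the fourth.\<close>
            have "p d \<in> {x, y, z, u}"
              using permutes_in_image[OF p(1), of d] double_transposition(2) t(2) by blast
            moreover have "p d \<noteq> x" "p d \<noteq> y" "p d \<noteq> z"
              using double_transposition(1) inj_eq[OF permutes_inj[OF p(1)]] p
              by (metis distinct_length_2_or_more)+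
            ultimately have "p d = u"
              by blast
            then have "p \<circ> \<sigma> \<circ> inv' p = g"
              unfolding double_transposition(3) t(3)
              using conjugation_of_double_transposition[OF permutes_bij[OF p(1)], of a b c d]
                double_transposition(1) p by simp
            then have "g \<in> C"
              unfolding C_def by (rule conjugate_in_orbit[OF p(1)])
            moreover have "g ^^ 3 = g"
              unfolding t(3) by (intro funpow_of_small_order double_transposition_squared t(1))
            ultimately show ?thesis
              by (simp add: alt_group_pow)
          qed
        qed (simp add: alt_group_pow alt_group_one)
      qed (use that C_pow[OF \<sigma>3] in auto)
    qed
  qed
qed

section \<open>Words whose values form one equivalence class\<close>

text \<open>
  Word images contain the inverses of word values, so an equivalence class can only be realised
  because it is closed under inversion.
\<close>

lemma inverse_in_automorphism_orbit:
  assumes \<sigma>: "\<sigma> \<in> carrier (alt_group n)"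
    and c: "c \<in> {\<alpha> \<sigma> | \<alpha>. \<alpha> \<in> iso (alt_group n) (alt_group n)}"
  shows "inv\<^bsub>alt_group n\<^esub> c \<in> {\<alpha> \<sigma> | \<alpha>. \<alpha> \<in> iso (alt_group n) (alt_group n)}"
proof -
  obtain \<alpha> where \<alpha>: "\<alpha> \<in> iso (alt_group n) (alt_group n)" "c = \<alpha> \<sigma>"
    using c by blast
  interpret \<alpha>: group_hom "alt_group n" "alt_group n" \<alpha>
    using \<alpha>(1) alt_group_is_group by (auto simp: group_hom_def group_hom_axioms_def iso_def)
  obtain s where s: "s permutes {1..n}" "s \<circ> \<sigma> \<circ> inv' s = inv' \<sigma>"
    using permutation_conjugate_to_inverse[of \<sigma> "{1..n}"] \<sigma> by (auto simp: alt_group_carrier)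
  have "inv\<^bsub>alt_group n\<^esub> c = (\<alpha> \<circ> (\<lambda>\<tau>. s \<circ> \<tau> \<circ> inv' s)) \<sigma>"
    using \<alpha>.hom_inv[OF \<sigma>] \<alpha>(2) s(2) by (simp add: alt_group_inv_equality[OF \<sigma>])
  moreover have "\<alpha> \<circ> (\<lambda>\<tau>. s \<circ> \<tau> \<circ> inv' s) \<in> iso (alt_group n) (alt_group n)"
    by (rule iso_set_trans[OF conjugation_iso_alt_group[OF s(1)] \<alpha>(1)])
  ultimately show ?thesis
    by blast
qed

theorem theorem1p4:
  fixes n :: nat and C :: "(nat \<Rightarrow> nat) set"
  assumes "equivalence_class (alt_group n) C"
    and "\<And>a. a \<in> C \<Longrightarrow> card (perm_support n a) \<le> 10"
  shows "\<exists>k. \<exists>w \<in> carrier (free_group k).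
           word_image (alt_group n) k w = {\<one>\<^bsub>alt_group n\<^esub>} \<union> C"
proof -
  interpret A: group "alt_group n"
    by (rule alt_group_is_group)
  obtain \<sigma> where \<sigma>: "\<sigma> \<in> carrier (alt_group n)"
    and C: "C = {\<alpha> \<sigma> | \<alpha>. \<alpha> \<in> iso (alt_group n) (alt_group n)}"
    using assms(1) A.equivalence_class_iff by blast
  obtain k w where w: "w \<in> carrier (free_group k)"
    and w_values: "(\<lambda>g. word_value (alt_group n) g w) ` ({..<k} \<rightarrow> carrier (alt_group n))
      = {\<one>\<^bsub>alt_group n\<^esub>} \<union> C"
  proof (cases "n < 5")
    case True
    show thesis
      by (rule word_for_orbit_in_small_alt_group[OF True \<sigma>, folded C]) (rule that)
  next
    case False
    then have n: "n \<ge> 5"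
      by simp
    have fin: "finite (carrier (alt_group n))"
      by (rule finite_subset[OF _ finite_permutations[of "{1..n}"]]) (auto simp: alt_group_carrier)
    show thesis
      by (rule simple_group.word_values_eq_automorphism_orbit
          [OF alt_group_simple[OF n] fin alt_group_not_comm[OF n] \<sigma>, folded C]) (rule that)
  qed
  have "word_image (alt_group n) k w = {\<one>\<^bsub>alt_group n\<^esub>} \<union> C
      \<union> (\<lambda>x. inv\<^bsub>alt_group n\<^esub> x) ` ({\<one>\<^bsub>alt_group n\<^esub>} \<union> C)"
    unfolding word_image_def w_values[symmetric] by blast
  moreover have "(\<lambda>x. inv\<^bsub>alt_group n\<^esub> x) ` ({\<one>\<^bsub>alt_group n\<^esub>} \<union> C)
      \<subseteq> {\<one>\<^bsub>alt_group n\<^esub>} \<union> C"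
    using inverse_in_automorphism_orbit[OF \<sigma>] unfolding C by auto
  ultimately show ?thesis
    using w by blast
qed

end
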